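(* Let $\mathcal{H}_A,\mathcal{H}_B,\mathcal{H}_C$ be finite-dimensional complex Hilbert spaces, let $\sigma_{BC}$ be a full-rank density operator on $\mathcal{H}_B\otimes\mathcal{H}_C$, and let $\sigma_C=\operatorname{tr}_B(\sigma_{BC})$. Then for every positive (semidefinite) operator $X_{ABC}$ on $\mathcal{H}_A\otimes\mathcal{H}_B\otimes\mathcal{H}_C$, $$\operatorname{tr}_{C}\big((1_{AB}\otimes\sigma_C^{-1/2})\,X_{ABC}\,(1_{AB}\otimes\sigma_C^{-1/2})\big)\;\leq\; \operatorname{tr}_{BC}\big((1_A\otimes\sigma_{BC}^{-1/2})\, X_{ABC}\,(1_A\otimes\sigma_{BC}^{-1/2})\big)\otimes 1_B$$ as an inequality of operators on $\mathcal{H}_A\otimes\mathcal{H}_B$.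
   Context: A density operator (state) is a positive semidefinite operator of trace one. $\operatorname{tr}_B$, $\operatorname{tr}_C$ and $\operatorname{tr}_{BC}$ denote partial traces over the indicated tensor factors, so $\operatorname{tr}_C$ maps operators on $\mathcal{H}_A\otimes\mathcal{H}_B\otimes\mathcal{H}_C$ to operators on $\mathcal{H}_A\otimes\mathcal{H}_B$ and $\operatorname{tr}_{BC}$ maps them to operators on $\mathcal{H}_A$. $1_A$, $1_B$ and $1_{AB}$ denote the identity operators on $\mathcal{H}_A$, $\mathcal{H}_B$ and $\mathcal{H}_A\otimes\mathcal{H}_B$. The reduced state $\sigma_C$ is invertible because $\sigma_{BC}$ has full rank. For self-adjoint operators, $S\le T$ means that $T-S$ is positive semidefinite. *)

theory Defs
  imports "HOL-Analysis.Analysis"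
begin

text \<open>
  A finite-dimensional complex Hilbert space is represented, by the choice of an orthonormal
  basis indexed by a finite type \<open>'n\<close>, as \<open>complex ^ 'n\<close>; its operators are the square matrices.
  The tensor product of the spaces indexed by \<open>'m\<close> and \<open>'n\<close> is the space indexed by \<open>'m \<times> 'n\<close>.
\<close>

type_synonym 'n operator = "complex ^ 'n ^ 'n"

definition cinner :: "complex ^ 'n \<Rightarrow> complex ^ 'n \<Rightarrow> complex"
  where "cinner v w = (\<Sum>i\<in>UNIV. cnj (v $ i) * w $ i)"

text \<open>
  Membership in \<open>\<real>\<^sub>\<ge>\<^sub>0\<close> asserts that the quadratic form is real as well as nonnegative;
  over the complex numbers this includes self-adjointness.
\<close>

definition positive_semidef :: "'n::finite operator \<Rightarrow> bool"
  where "positive_semidef S \<longleftrightarrow> (\<forall>v. cinner v (S *v v) \<in> \<real>\<^sub>\<ge>\<^sub>0)"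

definition loewner_le :: "'n::finite operator \<Rightarrow> 'n operator \<Rightarrow> bool"  (infix \<open>\<le>\<^sub>L\<close> 50)
  where "S \<le>\<^sub>L T \<longleftrightarrow> positive_semidef (T - S)"

definition density_operator :: "'n::finite operator \<Rightarrow> bool"
  where "density_operator \<rho> \<longleftrightarrow> positive_semidef \<rho> \<and> trace \<rho> = 1"

definition full_rank :: "'n::finite operator \<Rightarrow> bool"
  where "full_rank S \<longleftrightarrow> rank S = CARD('n)"

text \<open>The square root is meaningful for positive semidefinite operators only, and
  the inverse square root for invertible ones among them.\<close>

definition psd_sqrt :: "'n::finite operator \<Rightarrow> 'n operator"
  where "psd_sqrt S = (THE R. positive_semidef R \<and> R ** R = S)"

definition inv_sqrt :: "'n::finite operator \<Rightarrow> 'n operator"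
  where "inv_sqrt S = matrix_inv (psd_sqrt S)"

definition tensor_op ::
    "'m::finite operator \<Rightarrow> 'n::finite operator \<Rightarrow> ('m \<times> 'n) operator"  (infixr \<open>\<otimes>\<^sub>o\<close> 75)
  where "S \<otimes>\<^sub>o T = (\<chi> p q. S $ fst p $ fst q * T $ snd p $ snd q)"

definition ptrace_fst :: "('m::finite \<times> 'n::finite) operator \<Rightarrow> 'n operator"
  where "ptrace_fst S = (\<chi> j j'. \<Sum>i\<in>UNIV. S $ (i, j) $ (i, j'))"

definition ptrace_snd :: "('m::finite \<times> 'n::finite) operator \<Rightarrow> 'm operator"
  where "ptrace_snd S = (\<chi> i i'. \<Sum>j\<in>UNIV. S $ (i, j) $ (i', j))"

text \<open>
  The index type \<open>'a \<times> 'b \<times> 'c\<close> associates to the right, so an operator on \<open>A \<otimes> B \<otimes> C\<close> has to be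
  regrouped along the canonical isomorphism \<open>A \<otimes> (B \<otimes> C) \<cong> (A \<otimes> B) \<otimes> C\<close> before it can be
  multiplied by an operator of the form \<open>S\<^sub>A\<^sub>B \<otimes> T\<^sub>C\<close> or traced over \<open>C\<close> alone.
\<close>

definition regroup :: "('a::finite \<times> 'b::finite \<times> 'c::finite) operator \<Rightarrow> (('a \<times> 'b) \<times> 'c) operator"
  where "regroup X =
    (\<chi> p q. X $ (fst (fst p), snd (fst p), snd p) $ (fst (fst q), snd (fst q), snd q))"

end

theory Submission imports Defs begin

text \<open>
  Both sides are linear in the positive operator \<open>X\<close>, so it suffices to understand them on the
  rank-one summands of a decomposition \<open>X = Y Y\<^sup>*\<close>, taken here with \<open>Y = X\<^sup>1\<^sup>/\<^sup>2\<close>. Fix a vector \<open>v\<close> of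
  \<open>A \<otimes> B\<close> and a column \<open>u\<close> of \<open>Y\<close>. Write \<open>s\<^sub>b\<close> for the partial inner product of \<open>u\<close> with the
  \<open>A\<close>-component of \<open>v\<close> at the basis vector \<open>b\<close>; it is a vector of \<open>B \<otimes> C\<close>. Then the quadratic
  form at \<open>v\<close> of the right-hand side is \<open>\<Sum>\<^sub>b \<langle>s\<^sub>b, \<sigma>\<^sub>B\<^sub>C\<^sup>-\<^sup>1 s\<^sub>b\<rangle>\<close>, and that of the left-hand side is
  \<open>\<langle>t, \<sigma>\<^sub>C\<^sup>-\<^sup>1 t\<rangle>\<close>, where \<open>t = \<Sum>\<^sub>b \<langle>b| s\<^sub>b\<close> is a vector of \<open>C\<close>
  (\<open>cinner_ptrace_snd_gram\<close> and \<open>cinner_tensor_one\<close>).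

  What remains is the inequality \<open>\<langle>t, \<sigma>\<^sub>C\<^sup>-\<^sup>1 t\<rangle> \<le> \<Sum>\<^sub>b \<langle>s\<^sub>b, \<sigma>\<^sub>B\<^sub>C\<^sup>-\<^sup>1 s\<^sub>b\<rangle>\<close> for arbitrary families \<open>s\<^sub>b\<close>
  (\<open>inv_sqrt_ptrace_le\<close>). With \<open>y = \<sigma>\<^sub>C\<^sup>-\<^sup>1 t\<close>, the difference of the two sides is
  \<open>\<Sum>\<^sub>b \<langle>z\<^sub>b, \<sigma>\<^sub>B\<^sub>C z\<^sub>b\<rangle> \<ge> 0\<close> for \<open>z\<^sub>b = \<sigma>\<^sub>B\<^sub>C\<^sup>-\<^sup>1 s\<^sub>b - b \<otimes> y\<close>: the mixed terms sum to \<open>\<langle>y, t\<rangle>\<close> by the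
  definition of \<open>t\<close>, and the terms quadratic in \<open>y\<close> sum to \<open>\<langle>y, \<sigma>\<^sub>C y\<rangle> = \<langle>y, t\<rangle>\<close> by the definition
  of the partial trace.

  The other half of the work is to show that positive semidefinite matrices have exactly one
  positive semidefinite square root, so that \<open>inv_sqrt\<close> means what it should. Existence comes from
  an orthonormal eigenbasis, uniqueness from a trace argument.
\<close>

section \<open>Eigenbases of self-adjoint real-linear maps\<close>

text \<open>
  A unit vector \<open>v\<close> of \<open>V\<close> at which the quadratic form of \<open>f\<close> is maximal is an eigenvector: with \<open>c\<close>
  the maximal value, \<open>c - f\<close> is positive semidefinite on \<open>V\<close> and its form vanishes at \<open>v\<close>, so \<open>c - f\<close>
  must annihilate \<open>v\<close>.
\<close>

lemma self_adjoint_eigenvector: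
  fixes f :: "'v::euclidean_space \<Rightarrow> 'v"
  assumes lin: "linear f" and adj: "\<And>x y. f x \<bullet> y = x \<bullet> f y"
    and V: "subspace V" "\<And>x. x \<in> V \<Longrightarrow> f x \<in> V" "V \<noteq> {0}"
  obtains v c where "v \<in> V" "norm v = 1" "f v = c *\<^sub>R v"
proof -
  let ?K = "V \<inter> sphere 0 1"
  obtain u where u: "u \<in> V" "u \<noteq> 0"
    using V(1,3) subspace_0 by blast
  have "(1 / norm u) *\<^sub>R u \<in> ?K"
    using u V(1) by (simp add: subspace_scale)
  moreover have "compact ?K"
    using V(1) by (intro closed_Int_compact closed_subspace) auto
  moreover have "continuous_on ?K (\<lambda>x. f x \<bullet> x)"
    by (intro continuous_intros linear_continuous_on linear_conv_bounded_linear[THEN iffD1] lin)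
  ultimately have "\<exists>v\<in>?K. \<forall>x\<in>?K. f x \<bullet> x \<le> f v \<bullet> v"
    by (intro continuous_attains_sup) auto
  then obtain v where v: "v \<in> ?K" and vmax: "\<And>x. x \<in> ?K \<Longrightarrow> f x \<bullet> x \<le> f v \<bullet> v"
    by blast
  define c where "c = f v \<bullet> v"
  define g where "g x = c *\<^sub>R x - f x" for x
  have linf: "f (x + y) = f x + f y" "f (t *\<^sub>R x) = t *\<^sub>R f x" for x y t
    using lin by (simp_all add: linear_add linear_scale)
  have g_nonneg: "0 \<le> g x \<bullet> x" if "x \<in> V" for x
  proof (cases "x = 0")
    case False
    have "(1 / norm x) *\<^sub>R x \<in> ?K"
      using that False V(1) by (simp add: subspace_scale)
    from vmax[OF this] have "(f x \<bullet> x) / (norm x)\<^sup>2 \<le> c"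
      by (simp add: linf c_def power2_eq_square)
    then have "f x \<bullet> x \<le> c * (norm x)\<^sup>2"
      using False by (simp add: divide_simps)
    then show ?thesis
      by (simp add: g_def inner_diff_left power2_norm_eq_inner)
  qed (simp add: g_def)
  define w where "w = g v"
  have "w \<in> V"
    using v V by (auto simp: w_def g_def intro: subspace_diff subspace_scale)
  have "g v \<bullet> v = 0"
    using v by (simp add: g_def c_def inner_diff_left norm_eq_1)
  have "w = 0"
  proof (rule ccontr)
    assume "w \<noteq> 0"
    define d where "d = g w \<bullet> w"
    \<comment> \<open>The form of \<open>g\<close> at \<open>v + t w\<close> is \<open>2 t (w \<bullet> w) + t\<^sup>2 d\<close>, negative for small negative \<open>t\<close>. Its
      minimizer is \<open>- (w \<bullet> w) / d\<close>; the denominator \<open>d + 1\<close> covers \<open>d = 0\<close> as well.\<close>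
    define t where "t = - (w \<bullet> w) / (d + 1)"
    have d: "0 \<le> d"
      using g_nonneg \<open>w \<in> V\<close> by (simp add: d_def)
    have g_add: "g (v + t *\<^sub>R w) = g v + t *\<^sub>R g w"
      by (simp add: g_def linf algebra_simps)
    have "g w \<bullet> v = w \<bullet> w"
      using adj[of w v] by (simp add: g_def[of w] inner_diff_left) (simp add: w_def g_def inner_diff_right)
    then have "g (v + t *\<^sub>R w) \<bullet> (v + t *\<^sub>R w) = 2 * t * (w \<bullet> w) + t\<^sup>2 * d"
      using \<open>g v \<bullet> v = 0\<close>
      unfolding g_add by (simp add: inner_add_left inner_add_right d_def power2_eq_square algebra_simps flip: w_def)
    also have "\<dots> = - (w \<bullet> w)\<^sup>2 * (d + 2) / (d + 1)\<^sup>2"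
    proof -
      have td: "t * (d + 1) = - (w \<bullet> w)"
        using d by (simp add: t_def)
      have "(2 * t * (w \<bullet> w) + t\<^sup>2 * d) * (d + 1)\<^sup>2 = - (w \<bullet> w)\<^sup>2 * (d + 2)"
        using td by algebra
      moreover have "(d + 1)\<^sup>2 \<noteq> 0"
        using d by simp
      ultimately show ?thesis
        by (simp only: nonzero_eq_divide_eq not_False_eq_True simp_thms)
    qed
    also have "\<dots> < 0"
      using d \<open>w \<noteq> 0\<close> by (intro divide_neg_pos mult_neg_pos) auto
    finally show False
      using g_nonneg[of "v + t *\<^sub>R w"] v \<open>w \<in> V\<close> V(1)
      by (auto simp: subspace_add subspace_scale)
  qed
  then show thesis
    using that[of v c] v by (simp add: w_def g_def)
qed

text \<open>
  The orthogonal complement of a maximal orthonormal set of eigenvectors is invariant; if it were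
  nonzero, it would contain a further eigenvector.
\<close>

lemma self_adjoint_eigenbasis:
  fixes f :: "'v::euclidean_space \<Rightarrow> 'v"
  assumes lin: "linear f" and adj: "\<And>x y. f x \<bullet> y = x \<bullet> f y"
  obtains B l where "finite B" "\<forall>b\<in>B. norm b = 1 \<and> f b = l b *\<^sub>R b"
    "\<forall>x. (\<Sum>b\<in>B. (x \<bullet> b) *\<^sub>R b) = x"
proof -
  define P where "P B \<longleftrightarrow> finite B \<and> pairwise orthogonal B \<and>
    (\<forall>b\<in>B. norm b = 1 \<and> (\<exists>c. f b = c *\<^sub>R b))" for B
  have card: "card B \<le> DIM('v)" if "P B" for B
  proof -
    have "0 \<notin> B"
      using that by (auto simp: P_def)
    then have "independent B"
      using that pairwise_orthogonal_independent by (auto simp: P_def)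
    then show ?thesis
      using independent_bound by blast
  qed
  have "P {}"
    by (simp add: P_def)
  then obtain B where B: "P B" and max: "\<And>B'. P B' \<Longrightarrow> card B' \<le> card B"
    using ex_has_greatest_nat[of P "{}" card "DIM('v) + 1"] card by fastforce
  define V where "V = {x. \<forall>b\<in>B. x \<bullet> b = 0}"
  have "subspace V"
    by (auto simp: V_def subspace_def inner_add_left)
  have "f x \<in> V" if "x \<in> V" for x
    using that B by (fastforce simp: V_def P_def adj)
  have "V = {0}"
  proof (rule ccontr)
    assume "V \<noteq> {0}"
    with \<open>subspace V\<close> \<open>\<And>x. x \<in> V \<Longrightarrow> f x \<in> V\<close> lin adj
    obtain v c where v: "v \<in> V" "norm v = 1" "f v = c *\<^sub>R v"
      using self_adjoint_eigenvector by metis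
    have "v \<notin> B"
      using v by (auto simp: V_def)
    have "P (insert v B)"
      using B v by (auto simp: P_def V_def pairwise_insert orthogonal_def inner_commute)
    from max[OF this] show False
      using \<open>v \<notin> B\<close> B by (simp add: P_def)
  qed
  have expand: "x = (\<Sum>b\<in>B. (x \<bullet> b) *\<^sub>R b)" for x
  proof -
    have "(\<Sum>b\<in>B. (x \<bullet> b) *\<^sub>R b) \<bullet> b' = x \<bullet> b'" if "b' \<in> B" for b'
    proof -
      have "(\<Sum>b\<in>B. (x \<bullet> b) *\<^sub>R b) \<bullet> b' = (\<Sum>b\<in>B. if b = b' then x \<bullet> b' else 0)"
        using B that unfolding inner_sum_left
        by (intro sum.cong) (auto simp: P_def pairwise_def orthogonal_def norm_eq_1)
      then show ?thesis
        using B that by (simp add: P_def)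
    qed
    then have "x - (\<Sum>b\<in>B. (x \<bullet> b) *\<^sub>R b) \<in> V"
      by (simp add: V_def inner_diff_left)
    then show ?thesis
      using \<open>V = {0}\<close> by simp
  qed
  have "\<forall>b\<in>B. f b = (f b \<bullet> b) *\<^sub>R b"
    using B by (auto simp: P_def norm_eq_1)
  moreover have "\<forall>b\<in>B. norm b = 1"
    using B by (simp add: P_def)
  ultimately show thesis
    using that[of B "\<lambda>b. f b \<bullet> b"] B expand[symmetric] by (auto simp: P_def)
qed

section \<open>Positive semidefinite matrices and their square roots\<close>

lemma cinner_simps:
  "cinner (u + v) w = cinner u w + cinner v w" "cinner u (v + w) = cinner u v + cinner u w"
  "cinner (u - v) w = cinner u w - cinner v w" "cinner u (v - w) = cinner u v - cinner u w"
  "cinner (c *s u) w = cnj c * cinner u w" "cinner u (c *s w) = c * cinner u w"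
  by (simp_all add: cinner_def ring_distribs sum.distrib sum_subtractf sum_distrib_left mult_ac)

lemma cinner_commute: "cinner w v = cnj (cinner v w)"
  by (simp add: cinner_def mult.commute)

text \<open>
  The real and imaginary parts translate between the complex inner product and the real inner
  product of \<open>complex ^ 'n\<close> as a real Euclidean space, where the eigenbasis lives.
\<close>

lemma Re_cinner: "Re (cinner v w) = v \<bullet> w"
  by (simp add: cinner_def inner_vec_def inner_complex_def)

lemma Im_cinner: "Im (cinner v w) = (\<i> *s v) \<bullet> w"
  by (simp add: cinner_simps flip: Re_cinner)

lemma cinner_self: "cinner v v = of_real ((norm v)\<^sup>2)"
  by (simp add: complex_eq_iff Re_cinner power2_norm_eq_inner) (simp add: cinner_def)

text \<open>Polarization: the form is real at \<open>v + w\<close> and at \<open>v + \<i>w\<close>.\<close>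

lemma positive_semidef_adjoint:
  assumes "positive_semidef S"
  shows "cinner (S *v v) w = cinner v (S *v w)"
proof -
  have im: "Im (cinner u (S *v u)) = 0" for u
    using assms by (simp add: positive_semidef_def complex_nonneg_Reals_iff)
  have "Im (cinner v (S *v w)) + Im (cinner w (S *v v)) = 0"
    using im[of "v + w"] im[of v] im[of w]
    by (simp add: matrix_vector_right_distrib cinner_simps)
  moreover have "Re (cinner v (S *v w)) - Re (cinner w (S *v v)) = 0"
    using im[of "v + \<i> *s w"] im[of v] im[of w]
    by (simp add: matrix_vector_right_distrib vector_scalar_commute cinner_simps)
  ultimately show ?thesis
    unfolding cinner_commute[of "S *v v" w] by (simp add: complex_eq_iff)
qed

lemma vec_scale_complex: "c *s v = Re c *\<^sub>R v + Im c *\<^sub>R (\<i> *s v)" for v :: "complex ^ 'n"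
  by (simp add: vec_eq_iff complex_eq_iff)

text \<open>
  The map \<open>g\<close> takes the square root of each eigenvalue on a real orthonormal eigenbasis of \<open>S\<close>. It
  is a priori only real-linear. It nevertheless commutes with multiplication by \<open>\<i>\<close>, because \<open>g\<close> acts
  as \<open>\<surd>c\<close> on the whole eigenspace of \<open>S\<close> for \<open>c\<close>, and this eigenspace is a complex subspace.
\<close>

lemma positive_semidef_sqrt_exists:
  fixes S :: "'n::finite operator"
  assumes "positive_semidef S"
  shows "\<exists>R. positive_semidef R \<and> R ** R = S"
proof -
  define f where "f = (*v) S"
  have lin: "linear f"
    unfolding f_def by (rule linearI) (simp_all add: vec_eq_iff matrix_vector_mult_def algebra_simps sum.distrib scaleR_sum_right)
  have f_adj: "f x \<bullet> y = x \<bullet> f y" for x y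
    using positive_semidef_adjoint[OF assms] by (metis f_def Re_cinner)
  obtain B l where eigenbasis: "finite B" "\<forall>b\<in>B. norm b = 1 \<and> f b = l b *\<^sub>R b"
      "\<forall>x. (\<Sum>b\<in>B. (x \<bullet> b) *\<^sub>R b) = x"
    by (rule self_adjoint_eigenbasis[OF lin f_adj])
  then have norm_b: "norm b = 1" and l: "f b = l b *\<^sub>R b" if "b \<in> B" for b
    using that by auto
  have expand: "x = (\<Sum>b\<in>B. (x \<bullet> b) *\<^sub>R b)" for x
    using eigenbasis(3) by simp
  have l_nonneg: "0 \<le> l b" if "b \<in> B" for b
  proof -
    have "l b = b \<bullet> f b"
      using l[OF that] norm_b[OF that] by (simp add: norm_eq_1)
    also have "\<dots> \<ge> 0"
      using assms by (simp add: f_def positive_semidef_def complex_nonneg_Reals_iff flip: Re_cinner)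
    finally show ?thesis .
  qed
  define g where "g x = (\<Sum>b\<in>B. (sqrt (l b) * (x \<bullet> b)) *\<^sub>R b)" for x
  have g_lin: "linear g"
    unfolding g_def
    by (rule linearI) (simp_all add: inner_add_left algebra_simps sum.distrib scaleR_sum_right)
  have g_adj: "g x \<bullet> y = x \<bullet> g y" for x y
    by (simp add: g_def inner_sum_left inner_sum_right inner_commute mult_ac)
  have g_eigen: "g y = sqrt c *\<^sub>R y" if "f y = c *\<^sub>R y" for c y
  proof -
    have "(sqrt (l b) * (y \<bullet> b)) *\<^sub>R b = (sqrt c * (y \<bullet> b)) *\<^sub>R b" if "b \<in> B" for b
    proof -
      have "c * (y \<bullet> b) = l b * (y \<bullet> b)"
        using f_adj[of y b] l[OF that] \<open>f y = c *\<^sub>R y\<close> by simp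
      then show ?thesis by auto
    qed
    then have "g y = (\<Sum>b\<in>B. (sqrt c * (y \<bullet> b)) *\<^sub>R b)"
      unfolding g_def by (rule sum.cong[OF refl])
    also have "\<dots> = sqrt c *\<^sub>R y"
      by (subst (3) expand) (simp add: scaleR_sum_right)
    finally show ?thesis .
  qed
  have g_sum: "g (\<Sum>b\<in>B. h b) = (\<Sum>b\<in>B. g (h b))" for h
    by (rule linear_sum[OF g_lin])
  have g_scale: "g (t *\<^sub>R x) = t *\<^sub>R g x" for t x
    by (rule linear_scale[OF g_lin])
  have scale_i_sum: "\<i> *s (\<Sum>b\<in>B. a b *\<^sub>R b) = (\<Sum>b\<in>B. a b *\<^sub>R (\<i> *s b))" for a
    by (simp add: vec_eq_iff sum_distrib_left mult_ac)
  have g_i: "g (\<i> *s x) = \<i> *s g x" for x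
  proof -
    have "g (\<i> *s b) = sqrt (l b) *\<^sub>R (\<i> *s b)" if "b \<in> B" for b
    proof (rule g_eigen)
      show "f (\<i> *s b) = l b *\<^sub>R (\<i> *s b)"
        using l[OF that] by (simp add: f_def vector_scalar_commute) (simp add: vec_eq_iff)
    qed
    then have "g (\<i> *s (\<Sum>b\<in>B. (x \<bullet> b) *\<^sub>R b)) = \<i> *s g x"
      unfolding g_def[of x] scale_i_sum g_sum g_scale
      by (intro sum.cong) (simp_all add: mult.commute)
    then show ?thesis
      using expand[of x] by simp
  qed
  have "g (c *s x) = c *s g x" for c x
    unfolding vec_scale_complex[of c] using g_i by (simp add: linear_add[OF g_lin] g_scale)
  then have "Vector_Spaces.linear (*s) (*s) g"
    by (simp add: Vector_Spaces.linear_iff vec.vector_space_axioms linear_add[OF g_lin])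
  then have R: "matrix g *v x = g x" for x
    by (rule matrix_works)
  have "g (g x) = f x" for x
  proof -
    have "g (g x) = (\<Sum>b\<in>B. (x \<bullet> b) *\<^sub>R f b)"
      unfolding g_def[of x] g_sum g_scale
      by (intro sum.cong) (simp_all add: l g_eigen[OF l] l_nonneg)
    also have "\<dots> = f x"
      by (subst (2) expand) (simp add: linear_sum[OF lin] linear_scale[OF lin])
    finally show ?thesis .
  qed
  then have "matrix g ** matrix g = S"
    by (simp add: matrix_eq R f_def flip: matrix_vector_mul_assoc)
  moreover have "positive_semidef (matrix g)"
    unfolding positive_semidef_def complex_nonneg_Reals_iff R Re_cinner Im_cinner
  proof (intro allI conjI)
    fix v
    have "v \<bullet> g v = (\<Sum>b\<in>B. sqrt (l b) * (v \<bullet> b)\<^sup>2)"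
      by (simp add: g_def inner_sum_right power2_eq_square mult_ac)
    then show "0 \<le> v \<bullet> g v"
      by (simp add: l_nonneg sum_nonneg)
    have "(\<i> *s x) \<bullet> y = - (x \<bullet> (\<i> *s y))" for x y :: "complex ^ 'n"
      by (simp add: cinner_simps flip: Re_cinner)
    then have "(\<i> *s v) \<bullet> g v = - ((\<i> *s v) \<bullet> g v)"
      using g_adj[of "\<i> *s v" v] by (metis g_i g_adj inner_commute)
    then show "(\<i> *s v) \<bullet> g v = 0"
      by simp
  qed
  ultimately show ?thesis by blast
qed

lemma cinner_axis_left: "cinner (axis i 1) v = v $ i"
  by (simp add: cinner_def axis_def if_distrib if_distribR cong: if_cong)

lemma matrix_vector_mult_axis: "(S *v axis j 1) $ i = S $ i $ j"
  for S :: "complex ^ 'n ^ 'm"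
  by (simp add: matrix_vector_mult_def axis_def if_distrib if_distribR cong: if_cong)

lemma self_adjoint_entry:
  assumes "\<And>v w. cinner (S *v v) w = cinner v (S *v w)"
  shows "S $ i $ j = cnj (S $ j $ i)"
  using assms[of "axis i 1" "axis j 1"] cinner_commute[of "S *v axis i 1" "axis j 1"]
  by (simp add: cinner_axis_left matrix_vector_mult_axis)

lemma positive_semidef_kernel:
  assumes "positive_semidef S" and "Re (cinner v (S *v v)) = 0"
  shows "S *v v = 0"
proof -
  obtain R where R: "positive_semidef R" "R ** R = S"
    using positive_semidef_sqrt_exists[OF assms(1)] by blast
  have "cinner v (S *v v) = cinner (R *v v) (R *v v)"
    using positive_semidef_adjoint[OF R(1), of v "R *v v"]
    by (simp add: matrix_vector_mul_assoc R(2))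
  then have "R *v v = 0"
    using assms(2) by (simp add: cinner_self)
  then show ?thesis
    by (simp flip: R(2) matrix_vector_mul_assoc)
qed

text \<open>
  Let \<open>D = R - T\<close>. Then \<open>R D + D T = R\<^sup>2 - T\<^sup>2 = 0\<close>; multiplying by \<open>D\<close> and taking traces gives
  \<open>tr (D R D) + tr (D T D) = 0\<close>. Both traces are sums of nonnegative numbers, so \<open>R D = 0 = T D\<close>,
  hence \<open>D\<^sup>2 = 0\<close> and, as \<open>D\<close> is self-adjoint, \<open>D = 0\<close>.
\<close>

lemma positive_semidef_sqrt_unique:
  fixes R T :: "'n::finite operator"
  assumes R: "positive_semidef R" and T: "positive_semidef T" and eq: "R ** R = T ** T"
  shows "R = T"
proof -
  define D where "D = R - T"
  have D_adj: "cinner (D *v v) w = cinner v (D *v w)" for v w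
    by (simp add: D_def matrix_vector_mult_diff_rdistrib cinner_simps
        positive_semidef_adjoint[OF R] positive_semidef_adjoint[OF T])
  have trace: "trace (D ** A ** D) = (\<Sum>i\<in>UNIV. cinner (D *v axis i 1) (A *v (D *v axis i 1)))"
    for A :: "'n operator"
  proof -
    have "cinner (D *v axis i 1) (A *v (D *v axis i 1)) = (D ** A ** D) $ i $ i" for i
      by (simp add: D_adj cinner_axis_left matrix_vector_mult_axis matrix_vector_mul_assoc matrix_mul_assoc)
    then show ?thesis
      by (simp add: trace_def)
  qed
  have "R *v (R *v x) = T *v (T *v x)" for x
    by (simp add: matrix_vector_mul_assoc eq)
  then have "R *v (D *v x) + D *v (T *v x) = 0" for x
    by (simp add: D_def matrix_vector_mult_diff_rdistrib matrix_vector_mult_diff_distrib)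
  then have "D *v (R *v (D *v x)) + D *v (D *v (T *v x)) = 0" for x
    by (metis matrix_vector_right_distrib matrix_vector_mult_0_right)
  then have "D ** R ** D + D ** (D ** T) = 0"
    by (simp add: matrix_eq matrix_vector_mult_add_rdistrib flip: matrix_vector_mul_assoc)
  then have "trace (D ** R ** D) + trace (D ** (D ** T)) = 0"
    unfolding trace_add[symmetric] by (simp add: trace_def)
  then have "trace (D ** R ** D) + trace (D ** T ** D) = 0"
    unfolding trace_mul_sym[of D "D ** T"] .
  then have "(\<Sum>i\<in>UNIV. Re (cinner (D *v axis i 1) (R *v (D *v axis i 1)))
      + Re (cinner (D *v axis i 1) (T *v (D *v axis i 1)))) = 0"
    unfolding trace by (simp add: sum.distrib complex_eq_iff)
  moreover have nonneg: "0 \<le> Re (cinner v (R *v v))" "0 \<le> Re (cinner v (T *v v))" for v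
    using R T by (auto simp: positive_semidef_def complex_nonneg_Reals_iff)
  ultimately have "Re (cinner (D *v axis i 1) (R *v (D *v axis i 1)))
      + Re (cinner (D *v axis i 1) (T *v (D *v axis i 1))) = 0" for i
    by (subst (asm) sum_nonneg_eq_0_iff) auto
  then have "Re (cinner (D *v axis i 1) (R *v (D *v axis i 1))) = 0"
    "Re (cinner (D *v axis i 1) (T *v (D *v axis i 1))) = 0" for i
    using nonneg by (smt (verit))+
  then have "D *v (D *v axis i 1) = 0" for i
    using positive_semidef_kernel[OF R] positive_semidef_kernel[OF T]
    by (metis D_def diff_self matrix_vector_mult_diff_rdistrib)
  then have "D *v axis i 1 = 0" for i
    using D_adj[of "axis i 1" "D *v axis i 1"] by (simp add: cinner_self) (simp add: cinner_def)
  then have "D = 0"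
    by (simp add: vec_eq_iff flip: matrix_vector_mult_axis)
  then show ?thesis
    by (simp add: D_def)
qed

lemma psd_sqrt:
  assumes "positive_semidef S"
  shows "positive_semidef (psd_sqrt S)" "psd_sqrt S ** psd_sqrt S = S"
proof -
  have "\<exists>!R. positive_semidef R \<and> R ** R = S"
    using positive_semidef_sqrt_exists[OF assms] positive_semidef_sqrt_unique by blast
  from theI'[OF this] show "positive_semidef (psd_sqrt S)" "psd_sqrt S ** psd_sqrt S = S"
    by (auto simp: psd_sqrt_def)
qed

section \<open>The inverse square root\<close>

lemma full_rank_kernel:
  fixes S :: "'n::finite operator"
  assumes "full_rank S" "S *v v = 0"
  shows "v = 0"
proof -
  have "vec.span (rows S) = UNIV"
    using assms(1)
    by (simp add: full_rank_def row_rank_def_gen vec.dimension_def card_cart_basis flip: vec.dim_eq_full)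
  then show ?thesis
    using assms(2) matrix_left_invertible_span_rows_gen matrix_left_invertible_ker by blast
qed

text \<open>
  These two facts are all that is used about \<open>inv_sqrt\<close>: together they say that
  \<open>\<parallel>S\<^sup>-\<^sup>1\<^sup>/\<^sup>2 v\<parallel>\<^sup>2 = \<langle>v, S\<^sup>-\<^sup>1 v\<rangle>\<close>.
\<close>

lemma inv_sqrt:
  fixes S :: "'n::finite operator"
  assumes S: "positive_semidef S" and ker: "\<And>v. S *v v = 0 \<Longrightarrow> v = 0"
  shows inv_sqrt_adjoint: "cinner (inv_sqrt S *v v) w = cinner v (inv_sqrt S *v w)"
    and inv_sqrt_square: "S *v (inv_sqrt S *v (inv_sqrt S *v v)) = v"
proof -
  let ?R = "psd_sqrt S" and ?Q = "inv_sqrt S"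
  note R = psd_sqrt[OF S]
  have R_square: "?R *v (?R *v v) = S *v v" for v
    by (simp add: matrix_vector_mul_assoc R(2))
  have "?R *v v = 0 \<Longrightarrow> v = 0" for v
    using ker[of v] R_square[of v] by simp
  then have "invertible ?R"
    by (metis invertible_left_inverse matrix_left_invertible_ker)
  then have "?R ** ?Q = mat 1"
    unfolding inv_sqrt_def matrix_inv_def invertible_def by (rule someI2_ex) auto
  then have RQ: "?R *v (?Q *v v) = v" for v
    by (simp add: matrix_vector_mul_assoc)
  show "cinner (?Q *v v) w = cinner v (?Q *v w)"
    by (metis RQ positive_semidef_adjoint[OF R(1)])
  show "S *v (?Q *v (?Q *v v)) = v"
    by (simp add: RQ flip: R_square)
qed

section \<open>The key inequality\<close>

definition basis_tensor :: "'b::finite \<Rightarrow> complex ^ 'c \<Rightarrow> complex ^ ('b \<times> 'c::finite)"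
  where "basis_tensor b y = (\<chi> p. if fst p = b then y $ snd p else 0)"

lemma sum_prod_UNIV: "(\<Sum>p\<in>UNIV. f p) = (\<Sum>b\<in>UNIV. \<Sum>c\<in>UNIV. f (b, c))"
  for f :: "'b::finite \<times> 'c::finite \<Rightarrow> 'x::comm_monoid_add"
  by (simp add: sum.cartesian_product case_prod_unfold flip: UNIV_Times_UNIV)

lemma cinner_basis_tensor: "cinner (basis_tensor b y) s = (\<Sum>c\<in>UNIV. cnj (y $ c) * s $ (b, c))"
proof -
  have "cinner (basis_tensor b y) s =
      (\<Sum>b'\<in>UNIV. if b' = b then (\<Sum>c\<in>UNIV. cnj (y $ c) * s $ (b', c)) else 0)"
    unfolding cinner_def sum_prod_UNIV by (intro sum.cong) (simp_all add: basis_tensor_def)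
  then show ?thesis by simp
qed

text \<open>
  The partial trace is the sum of the compressions of \<open>S\<close> along the isometries \<open>y \<mapsto> b \<otimes> y\<close>, and
  therefore inherits positivity and definiteness.
\<close>

lemma cinner_ptrace_fst:
  "cinner v (ptrace_fst S *v w) = (\<Sum>b\<in>UNIV. cinner (basis_tensor b v) (S *v basis_tensor b w))"
proof -
  have S: "(S *v basis_tensor b w) $ p = (\<Sum>c\<in>UNIV. S $ p $ (b, c) * w $ c)" for b p
  proof -
    have "(S *v basis_tensor b w) $ p =
        (\<Sum>b'\<in>UNIV. if b' = b then (\<Sum>c\<in>UNIV. S $ p $ (b', c) * w $ c) else 0)"
      unfolding matrix_vector_mult_def vec_lambda_beta sum_prod_UNIV
      by (intro sum.cong) (simp_all add: basis_tensor_def)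
    then show ?thesis by simp
  qed
  have "(ptrace_fst S *v w) $ c = (\<Sum>b\<in>UNIV. (S *v basis_tensor b w) $ (b, c))" for c
    unfolding S by (simp add: matrix_vector_mult_def ptrace_fst_def sum_distrib_right, subst sum.swap, rule refl)
  then have "cinner v (ptrace_fst S *v w)
      = (\<Sum>c\<in>UNIV. \<Sum>b\<in>UNIV. cnj (v $ c) * (S *v basis_tensor b w) $ (b, c))"
    unfolding cinner_def by (simp only: sum_distrib_left)
  also have "\<dots> = (\<Sum>b\<in>UNIV. cinner (basis_tensor b v) (S *v basis_tensor b w))"
    unfolding cinner_basis_tensor by (rule sum.swap)
  finally show ?thesis .
qed

lemma positive_semidef_ptrace_fst:
  assumes "positive_semidef S"
  shows "positive_semidef (ptrace_fst S)"
  using assms by (auto simp: positive_semidef_def cinner_ptrace_fst complex_nonneg_Reals_iff sum_nonneg)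

lemma ptrace_fst_kernel:
  fixes S :: "('b::finite \<times> 'c::finite) operator"
  assumes S: "positive_semidef S" and ker: "\<And>v. S *v v = 0 \<Longrightarrow> v = 0"
    and y: "ptrace_fst S *v y = 0"
  shows "y = 0"
proof -
  have "Re (cinner y (ptrace_fst S *v y)) = 0"
    using y by (simp add: cinner_def)
  then have "\<forall>b\<in>UNIV. Re (cinner (basis_tensor b y) (S *v basis_tensor b y)) = 0"
    unfolding cinner_ptrace_fst Re_sum using S
    by (subst (asm) sum_nonneg_eq_0_iff) (auto simp: positive_semidef_def complex_nonneg_Reals_iff)
  then have "basis_tensor b y = 0" for b :: 'b
    using positive_semidef_kernel[OF S] ker by blast
  then have "basis_tensor b y $ (b, c) = 0" for b :: 'b and c
    by simp
  then show ?thesis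
    by (simp add: vec_eq_iff basis_tensor_def)
qed

text \<open>
  In the notation of the proof, the difference of the two sides is the sum over \<open>b\<close> of the form
  of \<open>S\<close> at \<open>S\<^sup>-\<^sup>1 s\<^sub>b - b \<otimes> y\<close>, with \<open>y = P\<^sup>-\<^sup>1 t\<close> chosen as the minimizer of that sum.
\<close>

lemma inv_sqrt_ptrace_le:
  fixes S :: "('b::finite \<times> 'c::finite) operator" and s :: "'b \<Rightarrow> complex ^ ('b \<times> 'c)"
  assumes S: "positive_semidef S" and ker: "\<And>v. S *v v = 0 \<Longrightarrow> v = 0"
  shows "(norm (inv_sqrt (ptrace_fst S) *v (\<chi> c. \<Sum>b\<in>UNIV. s b $ (b, c))))\<^sup>2
    \<le> (\<Sum>b\<in>UNIV. (norm (inv_sqrt S *v s b))\<^sup>2)"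
proof -
  define P where "P = ptrace_fst S"
  have P: "positive_semidef P" and P_ker: "P *v v = 0 \<Longrightarrow> v = 0" for v
    using positive_semidef_ptrace_fst ptrace_fst_kernel S ker by (auto simp: P_def)
  define t where "t = (\<chi> c. \<Sum>b\<in>UNIV. s b $ (b, c))"
  define y where "y = inv_sqrt P *v (inv_sqrt P *v t)"
  define r where "r b = inv_sqrt S *v (inv_sqrt S *v s b)" for b
  have y: "P *v y = t" and r: "S *v r b = s b" for b
    by (simp_all add: y_def r_def inv_sqrt_square P P_ker S ker)
  have norm_t: "(norm (inv_sqrt P *v t))\<^sup>2 = Re (cinner y t)"
    using cinner_self[of "inv_sqrt P *v t"] inv_sqrt_adjoint[OF P P_ker, of "inv_sqrt P *v t" t]
    by (simp add: y_def)
  have norm_s: "(norm (inv_sqrt S *v s b))\<^sup>2 = Re (cinner (r b) (s b))" for b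
    using cinner_self[of "inv_sqrt S *v s b"] inv_sqrt_adjoint[OF S ker, of "inv_sqrt S *v s b" "s b"]
    by (simp add: r_def)
  define e where "e b = basis_tensor b y" for b :: 'b
  have sum_es: "(\<Sum>b\<in>UNIV. cinner (e b) (s b)) = cinner y t"
    unfolding e_def cinner_basis_tensor
    unfolding cinner_def t_def vec_lambda_beta sum_distrib_left
    by (rule sum.swap)
  have sum_eSe: "(\<Sum>b\<in>UNIV. cinner (e b) (S *v e b)) = cinner y t"
    unfolding e_def using cinner_ptrace_fst[of y S y] y by (simp add: P_def)
  have expand: "Re (cinner (r b - e b) (S *v (r b - e b))) = Re (cinner (r b) (s b))
      - 2 * Re (cinner (e b) (s b)) + Re (cinner (e b) (S *v e b))" for b
  proof -
    have "cinner (r b) (S *v e b) = cnj (cinner (e b) (s b))"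
      by (metis r positive_semidef_adjoint[OF S] cinner_commute)
    then show ?thesis
      by (simp add: matrix_vector_mult_diff_distrib cinner_simps r)
  qed
  have "0 \<le> (\<Sum>b\<in>UNIV. Re (cinner (r b - e b) (S *v (r b - e b))))"
    using S by (intro sum_nonneg) (auto simp: positive_semidef_def complex_nonneg_Reals_iff)
  also have "\<dots> = (\<Sum>b\<in>UNIV. Re (cinner (r b) (s b))) - Re (cinner y t)"
    unfolding expand using sum_es sum_eSe
    by (simp add: sum.distrib sum_subtractf flip: sum_distrib_left Re_sum)
  finally show ?thesis
    by (simp add: norm_t norm_s flip: P_def t_def)
qed

section \<open>The quadratic forms of both sides\<close>

text \<open>
  Each rank-one summand \<open>|u\<^sub>k\<rangle>\<langle>u\<^sub>k|\<close> of \<open>Z\<close> contributes the squared norm of \<open>Q\<close> applied to the partial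
  inner product of \<open>v\<close> with \<open>u\<^sub>k\<close>. The same formula serves both sides of the theorem: with first
  factor \<open>A \<otimes> B\<close> on the left and with first factor \<open>A\<close> on the right.
\<close>

lemma cinner_ptrace_snd_gram:
  fixes Q :: "'n::finite operator" and Z :: "('m::finite \<times> 'n) operator"
  assumes Q: "\<And>i j. Q $ i $ j = cnj (Q $ j $ i)"
    and Z: "\<And>p q. Z $ p $ q = (\<Sum>k\<in>K. u k p * cnj (u k q))"
  shows "cinner v (ptrace_snd (((mat 1 :: 'm operator) \<otimes>\<^sub>o Q) ** Z ** ((mat 1 :: 'm operator) \<otimes>\<^sub>o Q)) *v v)
    = of_real (\<Sum>k\<in>K. (norm (Q *v (\<chi> j. \<Sum>i\<in>UNIV. cnj (v $ i) * u k (i, j))))\<^sup>2)"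
proof -
  let ?I = "(mat 1 :: 'm operator) \<otimes>\<^sub>o Q"
  define w where "w k i j = (\<Sum>j'\<in>UNIV. Q $ j $ j' * u k (i, j'))" for k i j
  have left: "(\<Sum>p\<in>UNIV. ?I $ (i, j) $ p * h p) = (\<Sum>j'\<in>UNIV. Q $ j $ j' * h (i, j'))" for i j h
  proof -
    have "(\<Sum>p\<in>UNIV. ?I $ (i, j) $ p * h p) =
        (\<Sum>i'\<in>UNIV. if i = i' then (\<Sum>j'\<in>UNIV. Q $ j $ j' * h (i', j')) else 0)"
      unfolding sum_prod_UNIV by (intro sum.cong) (simp_all add: tensor_op_def mat_def)
    then show ?thesis by simp
  qed
  have right: "(\<Sum>p\<in>UNIV. h p * ?I $ p $ (i, j)) = (\<Sum>j'\<in>UNIV. h (i, j') * cnj (Q $ j $ j'))" for i j h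
  proof -
    have "(\<Sum>p\<in>UNIV. h p * ?I $ p $ (i, j)) =
        (\<Sum>i'\<in>UNIV. if i' = i then (\<Sum>j'\<in>UNIV. h (i', j') * cnj (Q $ j $ j')) else 0)"
      unfolding sum_prod_UNIV by (intro sum.cong) (auto simp: tensor_op_def mat_def Q[of _ j])
    then show ?thesis by simp
  qed
  have "(?I ** Z ** ?I) $ (i, j) $ (i', j') = (\<Sum>k\<in>K. w k i j * cnj (w k i' j'))" for i j i' j'
  proof -
    have "(?I ** Z) $ (i, j) $ q = (\<Sum>k\<in>K. w k i j * cnj (u k q))" for q
      unfolding matrix_matrix_mult_def vec_lambda_beta left Z w_def
      by (simp add: sum_distrib_left sum_distrib_right mult_ac, subst sum.swap, rule refl)
    then have "(?I ** Z ** ?I) $ (i, j) $ (i', j')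
        = (\<Sum>q\<in>UNIV. (\<Sum>k\<in>K. w k i j * cnj (u k q)) * ?I $ q $ (i', j'))"
      by (simp add: matrix_matrix_mult_def[of "?I ** Z"])
    also have "\<dots> = (\<Sum>j''\<in>UNIV. \<Sum>k\<in>K. w k i j * (cnj (Q $ j' $ j'') * cnj (u k (i', j''))))"
      unfolding right unfolding sum_distrib_right by (simp add: mult_ac)
    also have "\<dots> = (\<Sum>k\<in>K. w k i j * cnj (w k i' j'))"
      unfolding w_def by (subst sum.swap) (simp add: sum_distrib_left)
    finally show ?thesis .
  qed
  then have "cinner v (ptrace_snd (?I ** Z ** ?I) *v v)
      = (\<Sum>i\<in>UNIV. cnj (v $ i) * (\<Sum>i'\<in>UNIV. (\<Sum>j\<in>UNIV. \<Sum>k\<in>K. w k i j * cnj (w k i' j)) * v $ i'))"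
    by (simp add: cinner_def matrix_vector_mult_def ptrace_snd_def)
  also have "\<dots> = (\<Sum>i\<in>UNIV. \<Sum>i'\<in>UNIV. \<Sum>j\<in>UNIV. \<Sum>k\<in>K. (cnj (v $ i) * w k i j) * cnj (cnj (v $ i') * w k i' j))"
    by (simp add: sum_distrib_left sum_distrib_right mult_ac)
  also have "\<dots> = (\<Sum>i\<in>UNIV. \<Sum>j\<in>UNIV. \<Sum>i'\<in>UNIV. \<Sum>k\<in>K. (cnj (v $ i) * w k i j) * cnj (cnj (v $ i') * w k i' j))"
    by (rule sum.cong[OF refl], rule sum.swap)
  also have "\<dots> = (\<Sum>j\<in>UNIV. \<Sum>i\<in>UNIV. \<Sum>i'\<in>UNIV. \<Sum>k\<in>K. (cnj (v $ i) * w k i j) * cnj (cnj (v $ i') * w k i' j))"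
    by (rule sum.swap)
  also have "\<dots> = (\<Sum>j\<in>UNIV. \<Sum>i\<in>UNIV. \<Sum>k\<in>K. \<Sum>i'\<in>UNIV. (cnj (v $ i) * w k i j) * cnj (cnj (v $ i') * w k i' j))"
    by (rule sum.cong[OF refl], rule sum.cong[OF refl], rule sum.swap)
  also have "\<dots> = (\<Sum>j\<in>UNIV. \<Sum>k\<in>K. \<Sum>i\<in>UNIV. \<Sum>i'\<in>UNIV. (cnj (v $ i) * w k i j) * cnj (cnj (v $ i') * w k i' j))"
    by (rule sum.cong[OF refl], rule sum.swap)
  also have "\<dots> = (\<Sum>k\<in>K. \<Sum>j\<in>UNIV. \<Sum>i\<in>UNIV. \<Sum>i'\<in>UNIV. (cnj (v $ i) * w k i j) * cnj (cnj (v $ i') * w k i' j))"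
    by (rule sum.swap)
  also have "\<dots> = (\<Sum>k\<in>K. \<Sum>j\<in>UNIV. (\<Sum>i\<in>UNIV. cnj (v $ i) * w k i j) * cnj (\<Sum>i\<in>UNIV. cnj (v $ i) * w k i j))"
    unfolding cnj_sum sum_product by (rule refl)
  also have "\<dots> = (\<Sum>k\<in>K. of_real ((norm (Q *v (\<chi> j. \<Sum>i\<in>UNIV. cnj (v $ i) * u k (i, j))))\<^sup>2))"
  proof (rule sum.cong[OF refl])
    fix k
    have "(Q *v (\<chi> j. \<Sum>i\<in>UNIV. cnj (v $ i) * u k (i, j))) $ j = (\<Sum>i\<in>UNIV. cnj (v $ i) * w k i j)" for j
      unfolding matrix_vector_mult_def vec_lambda_beta w_def sum_distrib_left
      by (subst sum.swap) (simp add: mult_ac)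
    then show "(\<Sum>j\<in>UNIV. (\<Sum>i\<in>UNIV. cnj (v $ i) * w k i j) * cnj (\<Sum>i\<in>UNIV. cnj (v $ i) * w k i j))
        = of_real ((norm (Q *v (\<chi> j. \<Sum>i\<in>UNIV. cnj (v $ i) * u k (i, j))))\<^sup>2)"
      unfolding cinner_self[symmetric] by (simp only: cinner_def mult.commute)
  qed
  finally show ?thesis
    by simp
qed

text \<open>
  Tensoring with \<open>1\<^sub>B\<close> makes the form a sum over the \<open>A\<close>-components of \<open>v\<close>; this is the source of
  the family indexed by \<open>b\<close> in the key inequality.
\<close>

lemma cinner_tensor_one:
  fixes T :: "'a::finite operator" and v :: "complex ^ ('a \<times> 'b::finite)"
  shows "cinner v ((T \<otimes>\<^sub>o (mat 1 :: 'b operator)) *v v)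
    = (\<Sum>b\<in>UNIV. cinner (\<chi> a. v $ (a, b)) (T *v (\<chi> a. v $ (a, b))))"
proof -
  have "((T \<otimes>\<^sub>o (mat 1 :: 'b operator)) *v v) $ (a, b) = (T *v (\<chi> a. v $ (a, b))) $ a" for a b
  proof -
    have "((T \<otimes>\<^sub>o (mat 1 :: 'b operator)) *v v) $ (a, b)
        = (\<Sum>a'\<in>UNIV. \<Sum>b'\<in>UNIV. if b' = b then T $ a $ a' * v $ (a', b') else 0)"
      unfolding matrix_vector_mult_def vec_lambda_beta sum_prod_UNIV
      by (intro sum.cong) (auto simp: tensor_op_def mat_def)
    then show ?thesis
      by (simp add: matrix_vector_mult_def)
  qed
  then show ?thesis
    unfolding cinner_def[of v] sum_prod_UNIV
    by (subst sum.swap) (simp add: cinner_def)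
qed

section \<open>The operator inequality\<close>

theorem mainTheorem1:
  fixes \<sigma>BC :: "('b::finite \<times> 'c::finite) operator"
    and \<sigma>C :: "'c operator"
    and X :: "('a::finite \<times> 'b \<times> 'c) operator"
  assumes "density_operator \<sigma>BC"
    and "full_rank \<sigma>BC"
    and "\<sigma>C = ptrace_fst \<sigma>BC"
    and "positive_semidef X"
  shows "ptrace_snd (((mat 1 :: ('a \<times> 'b) operator) \<otimes>\<^sub>o inv_sqrt \<sigma>C) ** regroup X
             ** ((mat 1 :: ('a \<times> 'b) operator) \<otimes>\<^sub>o inv_sqrt \<sigma>C))
         \<le>\<^sub>L ptrace_snd (((mat 1 :: 'a operator) \<otimes>\<^sub>o inv_sqrt \<sigma>BC) ** X
             ** ((mat 1 :: 'a operator) \<otimes>\<^sub>o inv_sqrt \<sigma>BC)) \<otimes>\<^sub>o (mat 1 :: 'b operator)"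
    (is "?L \<le>\<^sub>L ?T \<otimes>\<^sub>o _")
proof -
  have BC: "positive_semidef \<sigma>BC" and BC_ker: "\<sigma>BC *v v = 0 \<Longrightarrow> v = 0" for v
    using assms(1) full_rank_kernel[OF assms(2)] by (auto simp: density_operator_def)
  have C: "positive_semidef \<sigma>C" and C_ker: "\<sigma>C *v v = 0 \<Longrightarrow> v = 0" for v
    using positive_semidef_ptrace_fst ptrace_fst_kernel BC BC_ker assms(3) by auto
  obtain Y where Y: "positive_semidef Y" "Y ** Y = X"
    using positive_semidef_sqrt_exists[OF assms(4)] by blast
  have X: "X $ p $ q = (\<Sum>k\<in>UNIV. Y $ p $ k * cnj (Y $ q $ k))" for p q
    unfolding Y(2)[symmetric] matrix_matrix_mult_def
    by (simp add: self_adjoint_entry[OF positive_semidef_adjoint[OF Y(1)], of q])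
  \<comment> \<open>The partial inner product of column \<open>k\<close> of \<open>Y\<close> with the \<open>A\<close>-component of \<open>v\<close> at \<open>b\<close>.\<close>
  define s where "s v k b = (\<chi> j. \<Sum>a\<in>UNIV. cnj (v $ (a, b)) * Y $ (a, j) $ k)"
    for v :: "complex ^ ('a \<times> 'b)" and k and b :: 'b
  have L: "cinner v (?L *v v) = of_real (\<Sum>k\<in>UNIV.
      (norm (inv_sqrt \<sigma>C *v (\<chi> c. \<Sum>b\<in>UNIV. s v k b $ (b, c))))\<^sup>2)" for v
  proof -
    have "(\<Sum>i\<in>UNIV. cnj (v $ i) * Y $ (fst i, snd i, c) $ k) = (\<Sum>b\<in>UNIV. s v k b $ (b, c))" for c k
      unfolding s_def sum_prod_UNIV by (subst sum.swap) simp
    moreover have X': "regroup X $ p $ q = (\<Sum>k\<in>UNIV. Y $ (fst (fst p), snd (fst p), snd p) $ k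
        * cnj (Y $ (fst (fst q), snd (fst q), snd q) $ k))" for p q
      by (simp add: regroup_def X)
    ultimately show ?thesis
      by (subst cinner_ptrace_snd_gram[OF self_adjoint_entry[OF inv_sqrt_adjoint[OF C C_ker]] X']) simp_all
  qed
  have T: "cinner v ((?T \<otimes>\<^sub>o (mat 1 :: 'b operator)) *v v) =
      of_real (\<Sum>k\<in>UNIV. \<Sum>b\<in>UNIV. (norm (inv_sqrt \<sigma>BC *v s v k b))\<^sup>2)" for v
    unfolding cinner_tensor_one
    by (subst cinner_ptrace_snd_gram[OF self_adjoint_entry[OF inv_sqrt_adjoint[OF BC BC_ker]] X])
       (simp_all add: s_def, subst sum.swap, rule refl)
  show ?thesis
    unfolding loewner_le_def positive_semidef_def
  proof
    fix v
    have "(\<Sum>k\<in>UNIV. (norm (inv_sqrt \<sigma>C *v (\<chi> c. \<Sum>b\<in>UNIV. s v k b $ (b, c))))\<^sup>2)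
        \<le> (\<Sum>k\<in>UNIV. \<Sum>b\<in>UNIV. (norm (inv_sqrt \<sigma>BC *v s v k b))\<^sup>2)"
      unfolding assms(3) by (intro sum_mono inv_sqrt_ptrace_le[OF BC BC_ker])
    then show "cinner v ((?T \<otimes>\<^sub>o (mat 1 :: 'b operator) - ?L) *v v) \<in> \<real>\<^sub>\<ge>\<^sub>0"
      unfolding matrix_vector_mult_diff_rdistrib cinner_simps L T
        of_real_diff[symmetric] nonneg_Reals_of_real_iff by simp
  qed
qed

end
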